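(* Let $\chi:\mathbb{R}^2\to\mathbb{R}$ be a kernel as in the context, let $f\in D_b(\mathbb{R}^2)$ (that is, $f$ is $B$-differentiable at every point of $\mathbb{R}^2$), and suppose $D_Bf\in B(\mathbb{R}^2)$ (that is, $D_Bf$ is bounded). Then for every $w>0$, every $\delta_1,\delta_2>0$ and each $(x,y)\in\mathbb{R}^2$, $$\big|K_w^{\chi}(f;x,y)-f(x,y)\big|\le D\,\big(3\|D_Bf\|_\infty+\omega_B(D_Bf;\delta_1,\delta_2)\big)+\big[E\,\delta_1^{-1}+F\,\delta_2^{-1}+G\,\delta_1^{-1}\delta_2^{-1}\big]\,\omega_B(D_Bf;\delta_1,\delta_2),$$ where $$D=\frac1{4w^2}\big[M^0_{0,0}+2M^1_{1,0}+2M^1_{0,1}+4M^2_{1,1}\big],$$ $$E=\frac1{6w^3}\big[M^0_{0,0}+3M^2_{2,0}+3M^1_{1,0}+2M^1_{0,1}+6M^3_{2,1}+6M^2_{1,1}\big],$$ $$F=\frac1{6w^3}\big[M^0_{0,0}+3M^2_{0,2}+3M^1_{0,1}+2M^1_{1,0}+6M^3_{1,2}+6M^2_{1,1}\big],$$ $$G=\frac1{9w^4}\big[M^0_{0,0}+3M^2_{2,0}+3M^2_{0,2}+3M^1_{0,1}+3M^1_{1,0}+9M^4_{2,2}+9M^3_{1,2}+9M^3_{2,1}+9M^2_{1,1}\big].$$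
   Context: For $p=(p_1,p_2)\in\mathbb{N}_0^2$ with $p_1+p_2=\eta$, the absolute moments of $\chi$ are $$M^{\eta}_{p_1,p_2}=M^{\eta}_{(p_1,p_2)}(\chi)=\sup_{(u,v)\in\mathbb{R}^2}\sum_{k\in\mathbb{Z}}\sum_{j\in\mathbb{Z}}|\chi(u-k,v-j)|\,|u-k|^{p_1}|v-j|^{p_2},\qquad M_\eta(\chi)=\max_{p_1+p_2=\eta}M^{\eta}_{(p_1,p_2)}(\chi).$$ Standing assumptions on the kernel: $\chi\in C^0(\mathbb{R}^2)$ (continuous and bounded); (K1) $\chi$ is integrable and bounded at the origin; (K2) $\sum_{k\in\mathbb{Z}}\sum_{j\in\mathbb{Z}}\chi(u-k,v-j)=1$ for every $(u,v)\in\mathbb{R}^2$; (K3) $M_\eta(\chi)<+\infty$ for some $\eta=p_1+p_2$ with $p_1,p_2$ positive integers. For $f:\mathbb{R}^2\to\mathbb{R}$ put $\Delta_{(x,y)}f[x_0,y_0;x,y]=f(x,y)-f(x,y_0)-f(x_0,y)+f(x_0,y_0)$. The function $f$ is $B$-differentiable (Bögel differentiable) at $(x_0,y_0)$ if the limit $$D_B(f;x_0,y_0)=\lim_{(x,y)\to(x_0,y_0)}\frac{\Delta_{(x,y)}f[x_0,y_0;x,y]}{(x-x_0)(y-y_0)}$$ exists and is finite; $D_Bf$ denotes the function $(x_0,y_0)\mapsto D_B(f;x_0,y_0)$. $\|\cdot\|_\infty$ is the supremum norm on $\mathbb{R}^2$. For a function $h:\mathbb{R}^2\to\mathbb{R}$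 the mixed modulus of smoothness is $$\omega_B(h;\delta_1,\delta_2)=\sup\{|\Delta_{(x,y)}h[u,v;x,y]|:\ |x-u|<\delta_1,\ |y-v|<\delta_2\},\qquad \delta_1,\delta_2>0,$$ the supremum being over all $(x,y),(u,v)\in\mathbb{R}^2$ satisfying the inequalities. The GBS (Generalized Boolean Sum) operator of bivariate Kantorovich type is, for $w>0$, $$K_w^{\chi}(f;x,y)=\sum_{k\in\mathbb{Z}}\sum_{j\in\mathbb{Z}}\chi(wx-k,wy-j)\,w^2\int_{\frac kw}^{\frac{k+1}w}\int_{\frac jw}^{\frac{j+1}w}\big(f(x,v)+f(u,y)-f(u,v)\big)\,dv\,du,$$ where $u$ ranges over $(\frac kw,\frac{k+1}w)$ and $v$ over $(\frac jw,\frac{j+1}w)$. *)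

theory Defs
  imports "HOL-Analysis.Analysis"
begin

text \<open>Suprema and absolute series are taken in the extended nonnegative reals, so that they have
  their usual value \<open>\<infinity>\<close> when unbounded or divergent (with \<open>0 * \<infinity> = 0\<close>).\<close>

definition abs_moment :: "nat \<Rightarrow> nat \<Rightarrow> (real \<times> real \<Rightarrow> real) \<Rightarrow> ennreal" where
  "abs_moment p1 p2 chi =
     (SUP (u, v) \<in> UNIV.
        \<Sum>\<^sub>\<infinity>k. \<Sum>\<^sub>\<infinity>j.
          ennreal (\<bar>chi (u - real_of_int k, v - real_of_int j)\<bar>
                   * \<bar>u - real_of_int k\<bar> ^ p1 * \<bar>v - real_of_int j\<bar> ^ p2))"

definition max_abs_moment :: "nat \<Rightarrow> (real \<times> real \<Rightarrow> real) \<Rightarrow> ennreal" where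
  "max_abs_moment \<eta> chi = Max {abs_moment p1 p2 chi | p1 p2. p1 + p2 = \<eta>}"

text \<open>Boundedness and the moment condition together make \<open>abs_moment 0 0 chi\<close> finite, so the iterated
  series below converges absolutely, with sum \<open>1\<close>.\<close>

definition sampling_kernel :: "(real \<times> real \<Rightarrow> real) \<Rightarrow> bool" where
  "sampling_kernel chi \<longleftrightarrow>
     continuous_on UNIV chi \<and> bounded (range chi) \<and>
     integrable lborel chi \<and> (\<exists>r>0. bounded (chi ` ball (0, 0) r)) \<and>
     (\<forall>u v. (\<Sum>\<^sub>\<infinity>k. \<Sum>\<^sub>\<infinity>j. chi (u - real_of_int k, v - real_of_int j)) = 1) \<and>
     (\<exists>p1 p2. p1 > 0 \<and> p2 > 0 \<and> max_abs_moment (p1 + p2) chi < \<infinity>)"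

definition mixed_diff ::
  "(real \<times> real \<Rightarrow> real) \<Rightarrow> real \<times> real \<Rightarrow> real \<times> real \<Rightarrow> real" where
  "mixed_diff f = (\<lambda>(x0, y0) (x, y). f (x, y) - f (x, y0) - f (x0, y) + f (x0, y0))"

definition B_quotient ::
  "(real \<times> real \<Rightarrow> real) \<Rightarrow> real \<times> real \<Rightarrow> real \<times> real \<Rightarrow> real" where
  "B_quotient f p0 p = mixed_diff f p0 p / ((fst p - fst p0) * (snd p - snd p0))"

text \<open>Boegel's limit runs only over the points where the denominator is nonzero. Since \<open>0 / 0 = 0\<close> in
  HOL, the unrestricted limit at the point could only be \<open>0\<close>.\<close>

definition B_filter :: "real \<times> real \<Rightarrow> (real \<times> real) filter" where
  "B_filter p0 = at p0 within {p. fst p \<noteq> fst p0 \<and> snd p \<noteq> snd p0}"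

definition B_differentiable :: "(real \<times> real \<Rightarrow> real) \<Rightarrow> real \<times> real \<Rightarrow> bool" where
  "B_differentiable f p0 \<longleftrightarrow> (\<exists>L. (B_quotient f p0 \<longlongrightarrow> L) (B_filter p0))"

definition B_deriv :: "(real \<times> real \<Rightarrow> real) \<Rightarrow> real \<times> real \<Rightarrow> real" where
  "B_deriv f p0 = Lim (B_filter p0) (B_quotient f p0)"

definition sup_norm :: "(real \<times> real \<Rightarrow> real) \<Rightarrow> ennreal" where
  "sup_norm h = (SUP p. ennreal \<bar>h p\<bar>)"

definition mixed_modulus :: "(real \<times> real \<Rightarrow> real) \<Rightarrow> real \<Rightarrow> real \<Rightarrow> ennreal" where
  "mixed_modulus h \<delta>1 \<delta>2 =
     Sup {ennreal \<bar>mixed_diff h (u, v) (x, y)\<bar> | u v x y. \<bar>x - u\<bar> < \<delta>1 \<and> \<bar>y - v\<bar> < \<delta>2}"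

text \<open>No measurability of \<open>f\<close> is needed: the integrand equals
  \<open>f (x, y) - mixed_diff f (x, y) (u, v)\<close>, which is continuous in \<open>(u, v)\<close> when \<open>f\<close> is B-differentiable
  with bounded B-derivative.\<close>

definition GBS_Kantorovich ::
  "(real \<times> real \<Rightarrow> real) \<Rightarrow> real \<Rightarrow> (real \<times> real \<Rightarrow> real) \<Rightarrow> real \<times> real \<Rightarrow> real" where
  "GBS_Kantorovich chi w f = (\<lambda>(x, y).
     \<Sum>\<^sub>\<infinity>k. \<Sum>\<^sub>\<infinity>j.
       chi (w * x - real_of_int k, w * y - real_of_int j) * w\<^sup>2 *
       (LBINT u = ereal (real_of_int k / w) .. ereal ((real_of_int k + 1) / w).
         (LBINT v = ereal (real_of_int j / w) .. ereal ((real_of_int j + 1) / w).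
           f (x, v) + f (u, y) - f (u, v))))"

definition coeff_D :: "(real \<times> real \<Rightarrow> real) \<Rightarrow> real \<Rightarrow> ennreal" where
  "coeff_D chi w = ennreal (1 / (4 * w ^ 2)) *
     (abs_moment 0 0 chi + 2 * abs_moment 1 0 chi + 2 * abs_moment 0 1 chi + 4 * abs_moment 1 1 chi)"

definition coeff_E :: "(real \<times> real \<Rightarrow> real) \<Rightarrow> real \<Rightarrow> ennreal" where
  "coeff_E chi w = ennreal (1 / (6 * w ^ 3)) *
     (abs_moment 0 0 chi + 3 * abs_moment 2 0 chi + 3 * abs_moment 1 0 chi + 2 * abs_moment 0 1 chi
      + 6 * abs_moment 2 1 chi + 6 * abs_moment 1 1 chi)"

definition coeff_F :: "(real \<times> real \<Rightarrow> real) \<Rightarrow> real \<Rightarrow> ennreal" where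
  "coeff_F chi w = ennreal (1 / (6 * w ^ 3)) *
     (abs_moment 0 0 chi + 3 * abs_moment 0 2 chi + 3 * abs_moment 0 1 chi + 2 * abs_moment 1 0 chi
      + 6 * abs_moment 1 2 chi + 6 * abs_moment 1 1 chi)"

definition coeff_G :: "(real \<times> real \<Rightarrow> real) \<Rightarrow> real \<Rightarrow> ennreal" where
  "coeff_G chi w = ennreal (1 / (9 * w ^ 4)) *
     (abs_moment 0 0 chi + 3 * abs_moment 2 0 chi + 3 * abs_moment 0 2 chi + 3 * abs_moment 0 1 chi
      + 3 * abs_moment 1 0 chi + 9 * abs_moment 2 2 chi + 9 * abs_moment 1 2 chi
      + 9 * abs_moment 2 1 chi + 9 * abs_moment 1 1 chi)"

end

theory Submission
  imports Defs
begin

text \<open>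
  Write \<open>\<parallel>D\<^sub>B f\<parallel>\<close> for the supremum norm of the B-derivative. Every term on the right of the estimate is
  nonnegative, so it is enough to prove \<open>\<bar>K\<^sub>w f (x, y) - f (x, y)\<bar> \<le> D * \<parallel>D\<^sub>B f\<parallel>\<close>.

  The integrand of the operator is \<open>f (x, y)\<close> minus the mixed difference of \<open>f\<close> between \<open>(x, y)\<close> and
  \<open>(u, v)\<close>. Since the kernel sums to \<open>1\<close>, the error of the operator is therefore the kernel sum of
  averages of mixed differences over the grid cells. A mean value inequality (\<open>mixed_diff_le\<close>) bounds
  the mixed difference by \<open>\<parallel>D\<^sub>B f\<parallel> * \<bar>u - x\<bar> * \<bar>v - y\<bar>\<close>. On a cell of side \<open>1 / w\<close> the average of
  \<open>\<bar>u - x\<bar>\<close> is at most \<open>(1 + 2 * \<bar>w * x - k\<bar>) / (2 * w)\<close>, because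
  \<open>\<bar>u - x\<bar> \<le> (u - k / w) + \<bar>k / w - x\<bar>\<close>. The product of two such factors expands into the four monomials
  whose kernel sums are the moments in \<open>D\<close> (\<open>GBS_Kantorovich_error_le_finite_moments\<close>).

  The B-derivative may be discontinuous, so the mean value inequality cannot be obtained by
  integrating it; it comes from a local-to-global argument. Mixed differences are additive
  over subdivisions of a rectangle, and near any point B-differentiability gives the inequality, with
  a slightly larger constant, for every rectangle containing that point. A compactness argument in
  each coordinate then glues the small rectangles together.

  The operator is an iterated real series, while the moments are iterated series in the extended
  reals. Both are moved to absolutely convergent series over pairs \<open>(k, j)\<close>, which is possible when the
  moments in \<open>D\<close> are finite. If one of them is infinite, the bound is \<open>\<infinity>\<close> unless the B-derivative
  vanishes, and then \<open>f\<close> is reproduced exactly.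
\<close>

section \<open>The mean value inequality for B-differentiable functions\<close>

lemma B_filter_nontrivial: "B_filter p \<noteq> bot"
proof -
  have "p islimpt {q. fst q \<noteq> fst p \<and> snd q \<noteq> snd p}"
  proof (rule islimpt_approachable[THEN iffD2], intro allI impI)
    fix e :: real
    assume "e > 0"
    let ?q = "(fst p + e / 4, snd p + e / 4)"
    have "dist ?q p \<le> dist (fst ?q) (fst p) + dist (snd ?q) (snd p)"
      by (metis dist_Pair_Pair dist_real_def prod.collapse real_sqrt_sum_squares_triangle_ineq
          sqrt_sum_squares_le_sum_abs abs_abs)
    also have "\<dots> < e"
      using \<open>e > 0\<close> by (simp add: dist_real_def)
    finally have "dist ?q p < e" .
    moreover have "?q \<in> {q. fst q \<noteq> fst p \<and> snd q \<noteq> snd p}" "?q \<noteq> p"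
      using \<open>e > 0\<close> by (auto simp: prod_eq_iff)
    ultimately show "\<exists>q\<in>{q. fst q \<noteq> fst p \<and> snd q \<noteq> snd p}. q \<noteq> p \<and> dist q p < e"
      by blast
  qed
  then show ?thesis
    by (simp add: B_filter_def trivial_limit_within)
qed

lemma B_deriv_tendsto:
  assumes "B_differentiable f p"
  shows "(B_quotient f p \<longlongrightarrow> B_deriv f p) (B_filter p)"
  using assms unfolding B_differentiable_def B_deriv_def
  by (metis B_filter_nontrivial tendsto_Lim)

lemma abs_mixed_diff_swap:
  "\<bar>mixed_diff f (a, c) (b, d)\<bar> = \<bar>mixed_diff f (b, c) (a, d)\<bar>"
  "\<bar>mixed_diff f (a, c) (b, d)\<bar> = \<bar>mixed_diff f (a, d) (b, c)\<bar>"
  by (simp_all add: mixed_diff_def)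

text \<open>The limit says nothing about points on the two axes through \<open>(x, y)\<close>, but there the mixed
  difference is \<open>0\<close>, so the estimate covers a full square around \<open>(x, y)\<close>.\<close>

lemma mixed_diff_near_point_le:
  assumes "B_differentiable f (x, y)" and "\<bar>B_deriv f (x, y)\<bar> < K"
  obtains r where "r > 0"
    and "\<And>s t. \<bar>s - x\<bar> < r \<Longrightarrow> \<bar>t - y\<bar> < r \<Longrightarrow>
           \<bar>mixed_diff f (x, y) (s, t)\<bar> \<le> K * (\<bar>s - x\<bar> * \<bar>t - y\<bar>)"
proof -
  have "((\<lambda>q. \<bar>B_quotient f (x, y) q\<bar>) \<longlongrightarrow> \<bar>B_deriv f (x, y)\<bar>) (B_filter (x, y))"
    using B_deriv_tendsto[OF assms(1)] by (rule tendsto_rabs)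
  then have "\<forall>\<^sub>F q in B_filter (x, y). \<bar>B_quotient f (x, y) q\<bar> < K"
    using assms(2) by (rule order_tendstoD)
  then obtain d where "d > 0"
    and d: "\<And>q. fst q \<noteq> x \<Longrightarrow> snd q \<noteq> y \<Longrightarrow> dist q (x, y) < d \<Longrightarrow> \<bar>B_quotient f (x, y) q\<bar> < K"
    unfolding B_filter_def eventually_at by (metis (mono_tags, lifting) fst_conv mem_Collect_eq snd_conv)
  show ?thesis
  proof
    show "d / 2 > 0"
      using \<open>d > 0\<close> by simp
    fix s t
    assume near: "\<bar>s - x\<bar> < d / 2" "\<bar>t - y\<bar> < d / 2"
    show "\<bar>mixed_diff f (x, y) (s, t)\<bar> \<le> K * (\<bar>s - x\<bar> * \<bar>t - y\<bar>)"
    proof (cases "s = x \<or> t = y")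
      case True
      then show ?thesis
        by (auto simp: mixed_diff_def)
    next
      case False
      have "dist (s, t) (x, y) \<le> \<bar>s - x\<bar> + \<bar>t - y\<bar>"
        by (simp add: dist_Pair_Pair dist_real_def sqrt_sum_squares_le_sum_abs[of "s - x" "t - y"])
      then have "\<bar>B_quotient f (x, y) (s, t)\<bar> < K"
        using near False by (intro d) auto
      then show ?thesis
        using False by (simp add: B_quotient_def abs_mult divide_less_eq split: if_splits)
    qed
  qed
qed

text \<open>Bisection is applied once per coordinate. For a fixed abscissa \<open>x\<close>, bisecting in the second
  coordinate gives the bound on all rectangles over \<open>{c..d}\<close> whose base is a short interval around \<open>x\<close>;
  bisecting in the first coordinate then joins these strips. The hypothesis is strict so that the
  bound already holds for the difference quotients near each point.\<close>

lemma mixed_diff_rectangle_le: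
  assumes diff: "\<And>p. B_differentiable f p" and bound: "\<And>p. \<bar>B_deriv f p\<bar> < K"
    and "a \<le> b" "c \<le> d"
  shows "\<bar>mixed_diff f (a, c) (b, d)\<bar> \<le> K * ((b - a) * (d - c))"
proof -
  define P where "P a b c d \<longleftrightarrow> \<bar>mixed_diff f (a, c) (b, d)\<bar> \<le> K * ((b - a) * (d - c))" for a b c d
  have join_fst: "P a b' c d" if "P a b c d" "P b b' c d" for a b b' c d
    using that unfolding P_def mixed_diff_def by (auto simp: algebra_simps)
  have join_snd: "P a b c d'" if "P a b c d" "P a b d d'" for a b c d d'
    using that unfolding P_def mixed_diff_def by (auto simp: algebra_simps)
  have around: "\<exists>r>0. \<forall>a b c d. a \<le> x \<and> x \<le> b \<and> b - a < r \<and> c \<le> y \<and> y \<le> d \<and> d - c < r \<longrightarrow> P a b c d"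
    for x y
  proof -
    obtain r where "r > 0" and r: "\<And>s t. \<bar>s - x\<bar> < r \<Longrightarrow> \<bar>t - y\<bar> < r \<Longrightarrow>
        \<bar>mixed_diff f (x, y) (s, t)\<bar> \<le> K * (\<bar>s - x\<bar> * \<bar>t - y\<bar>)"
      using mixed_diff_near_point_le[OF diff bound] by metis
    have "P a b c d" if "a \<le> x" "x \<le> b" "b - a < r" "c \<le> y" "y \<le> d" "d - c < r" for a b c d
    proof -
      \<comment> \<open>Cutting at \<open>(x, y)\<close> makes it a corner of each piece, which is where the local estimate applies.\<close>
      have "P x b y d" "P a x y d" "P x b c y" "P a x c y"
        using that r[of b d] r[of a d] r[of b c] r[of a c]
          abs_mixed_diff_swap(1)[of f a y x d] abs_mixed_diff_swap(2)[of f x c b y]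
          abs_mixed_diff_swap(1)[of f a c x y] abs_mixed_diff_swap(2)[of f x c a y]
        unfolding P_def by (simp_all add: abs_minus_commute)
      then show ?thesis
        by (meson join_fst join_snd)
    qed
    with \<open>r > 0\<close> show ?thesis
      by blast
  qed
  have strip: "\<exists>r>0. \<forall>a b. a \<le> x \<and> x \<le> b \<and> b - a < r \<longrightarrow> P a b c d" for x
    using \<open>c \<le> d\<close>
  proof (induction c d rule: Bolzano)
    case (trans c d e)
    then obtain r s where "r > 0" "s > 0"
      and "\<And>a b. a \<le> x \<and> x \<le> b \<and> b - a < r \<Longrightarrow> P a b c d"
      and "\<And>a b. a \<le> x \<and> x \<le> b \<and> b - a < s \<Longrightarrow> P a b d e"
      by blast
    then show ?case
      by (intro exI[of _ "min r s"]) (auto intro: join_snd[of _ _ c d e])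
  next
    case (local y)
    then show ?case
      using around[of x y] by meson
  qed
  show ?thesis
    unfolding P_def[symmetric] using \<open>a \<le> b\<close>
  proof (induction a b rule: Bolzano)
    case (trans a b b')
    then show ?case by (blast intro: join_fst)
  next
    case (local x)
    then show ?case using strip[of x] by blast
  qed
qed

lemma mixed_diff_le:
  assumes diff: "\<And>p. B_differentiable f p" and bound: "\<And>p. \<bar>B_deriv f p\<bar> \<le> M"
  shows "\<bar>mixed_diff f (x, y) (u, v)\<bar> \<le> M * (\<bar>u - x\<bar> * \<bar>v - y\<bar>)"
proof -
  have ordered: "\<bar>mixed_diff f (a, c) (b, d)\<bar> \<le> M * ((b - a) * (d - c))" if "a \<le> b" "c \<le> d" for a b c d
  proof (rule tendsto_lowerbound)
    show "((\<lambda>K. K * ((b - a) * (d - c))) \<longlongrightarrow> M * ((b - a) * (d - c))) (at_right M)"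
      by (intro tendsto_intros)
    show "\<forall>\<^sub>F K in at_right M. \<bar>mixed_diff f (a, c) (b, d)\<bar> \<le> K * ((b - a) * (d - c))"
      using eventually_at_right_less
      by eventually_elim (rule mixed_diff_rectangle_le[OF diff _ that], meson bound le_less_trans)
  qed simp
  show ?thesis
    using ordered[of x u y v] ordered[of u x y v] ordered[of x u v y] ordered[of u x v y]
      abs_mixed_diff_swap(1)[of f x y u v] abs_mixed_diff_swap(1)[of f x v u y]
      abs_mixed_diff_swap(2)[of f x y u v]
    by (cases "x \<le> u"; cases "y \<le> v") (simp_all add: abs_minus_commute)
qed

section \<open>Averages over a cell of the sampling grid\<close>

text \<open>The linear majorant \<open>(t - a) + c\<close> is the bound for \<open>\<bar>t - x\<bar>\<close> on \<open>{a..b}\<close> with \<open>c = \<bar>a - x\<bar>\<close>; its integral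
  produces exactly the coefficients \<open>1 / 2\<close> and \<open>1\<close> that enter \<open>D\<close>.\<close>

lemma abs_interval_integral_le_linear:
  fixes h :: "real \<Rightarrow> real" and a b :: real
  assumes "a \<le> b" and cont: "continuous_on {a..b} h"
    and le: "\<And>t. t \<in> {a..b} \<Longrightarrow> \<bar>h t\<bar> \<le> C * ((t - a) + c)"
  shows "\<bar>LBINT t=a..b. h t\<bar> \<le> C * ((b - a)\<^sup>2 / 2 + c * (b - a))"
proof -
  have "LBINT t=a..b. h t = integral {a..b} h"
    using \<open>a \<le> b\<close> cont by (intro interval_integral_eq_integral borel_integrable_atLeastAtMost')
  moreover have "((\<lambda>t. C * ((t - a) + c)) has_integral
      C * ((b - a)\<^sup>2 / 2 + c * b) - C * ((a - a)\<^sup>2 / 2 + c * a)) {a..b}"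
    using \<open>a \<le> b\<close>
    by (intro fundamental_theorem_of_calculus)
      (auto simp flip: has_real_derivative_iff_has_vector_derivative
        intro!: derivative_eq_intros simp: field_simps)
  moreover have "h integrable_on {a..b}"
    using cont by (rule integrable_continuous_real)
  ultimately show ?thesis
    using integral_norm_bound_integral[of h "{a..b}" "\<lambda>t. C * ((t - a) + c)"] le
    by (simp add: has_integral_iff algebra_simps)
qed

text \<open>The function \<open>f\<close> itself may be discontinuous, even nonmeasurable, since a sum of a function of \<open>u\<close> and
  a function of \<open>v\<close> has zero mixed difference. The integrals exist because the combination
  under the integral sign cancels such parts: its deviation from \<open>f (x, y)\<close> is a mixed difference, which
  the hypothesis makes Lipschitz in each variable, and hence so is its inner integral.\<close>

lemma cell_integral_error_le:
  fixes a b c d :: real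
  assumes mixed: "\<And>x y u v. \<bar>mixed_diff f (x, y) (u, v)\<bar> \<le> M * (\<bar>u - x\<bar> * \<bar>v - y\<bar>)"
    and "M \<ge> 0" "a \<le> b" "c \<le> d"
  shows "\<bar>(LBINT u=a..b. (LBINT v=c..d. f (x, v) + f (u, y) - f (u, v))) - f (x, y) * ((b - a) * (d - c))\<bar>
    \<le> M * (((b - a)\<^sup>2 / 2 + \<bar>a - x\<bar> * (b - a)) * ((d - c)\<^sup>2 / 2 + \<bar>c - y\<bar> * (d - c)))"
proof -
  define g where "g u v = mixed_diff f (x, y) (u, v)" for u v
  define L where "L = (d - c)\<^sup>2 / 2 + \<bar>c - y\<bar> * (d - c)"
  define I where "I u = (LBINT v=c..d. g u v)" for u
  have "L \<ge> 0"
    using \<open>c \<le> d\<close> by (simp add: L_def)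
  \<comment> \<open>By additivity, \<open>g u v - g u v'\<close> is the mixed difference over the rectangle between \<open>(x, v')\<close> and \<open>(u, v)\<close>.\<close>
  have lip: "\<bar>g u v - g u v'\<bar> \<le> M * \<bar>u - x\<bar> * \<bar>v - v'\<bar>" for u v v'
    using mixed[of x v' u v] by (simp add: g_def mixed_diff_def algebra_simps)
  have cont_g: "continuous_on S (g u)" for S u
    by (rule lipschitz_on_continuous_on[of "M * \<bar>u - x\<bar>"])
      (use lip \<open>M \<ge> 0\<close> in \<open>auto intro!: lipschitz_onI simp: dist_real_def\<close>)
  have int_g: "interval_lebesgue_integrable lborel (ereal c) (ereal d) (g u)" for u
    by (rule interval_integrable_continuous_on) (use \<open>c \<le> d\<close> cont_g in auto)
  have near: "\<bar>t - z\<bar> \<le> (t - s) + \<bar>s - z\<bar>" if "s \<le> t" for s t z :: real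
    using that by linarith
  have I_le: "\<bar>I u\<bar> \<le> (M * \<bar>u - x\<bar>) * L" for u
    unfolding I_def L_def
  proof (rule abs_interval_integral_le_linear[OF \<open>c \<le> d\<close> cont_g])
    fix v assume "v \<in> {c..d}"
    then show "\<bar>g u v\<bar> \<le> (M * \<bar>u - x\<bar>) * ((v - c) + \<bar>c - y\<bar>)"
      using mixed[of x y u v] near[of c v y] \<open>M \<ge> 0\<close> unfolding g_def
      by (intro order_trans[OF mixed]) (auto simp: mult.assoc intro!: mult_left_mono)
  qed
  have I_lip: "\<bar>I u - I u'\<bar> \<le> (M * \<bar>u - u'\<bar>) * L" for u u'
  proof -
    have "I u - I u' = (LBINT v=c..d. g u v - g u' v)"
      unfolding I_def using int_g by (simp add: interval_lebesgue_integral_diff)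
    also have "\<bar>\<dots>\<bar> \<le> (M * \<bar>u - u'\<bar>) * L"
      unfolding L_def
    proof (rule abs_interval_integral_le_linear[OF \<open>c \<le> d\<close>])
      show "continuous_on {c..d} (\<lambda>v. g u v - g u' v)"
        by (intro continuous_intros cont_g)
      fix v assume "v \<in> {c..d}"
      have "\<bar>g u v - g u' v\<bar> \<le> M * (\<bar>u - u'\<bar> * \<bar>v - y\<bar>)"
        using mixed[of u' y u v] by (simp add: g_def mixed_diff_def algebra_simps)
      also have "\<dots> \<le> M * (\<bar>u - u'\<bar> * ((v - c) + \<bar>c - y\<bar>))"
        using \<open>v \<in> {c..d}\<close> near[of c v y] \<open>M \<ge> 0\<close> by (intro mult_left_mono) auto
      finally show "\<bar>g u v - g u' v\<bar> \<le> (M * \<bar>u - u'\<bar>) * ((v - c) + \<bar>c - y\<bar>)"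
        by (simp add: mult.assoc)
    qed
    finally show ?thesis .
  qed
  have cont_I: "continuous_on S I" for S
    by (rule lipschitz_on_continuous_on[of "M * L"])
      (use I_lip \<open>M \<ge> 0\<close> \<open>L \<ge> 0\<close> in \<open>auto intro!: lipschitz_onI simp: dist_real_def mult.assoc mult.left_commute mult.commute\<close>)
  have int_I: "interval_lebesgue_integrable lborel (ereal a) (ereal b) I"
    by (rule interval_integrable_continuous_on) (use \<open>a \<le> b\<close> cont_I in auto)
  have inner: "(LBINT v=c..d. f (x, v) + f (u, y) - f (u, v)) = f (x, y) * (d - c) - I u" for u
  proof -
    have "(LBINT v=c..d. f (x, v) + f (u, y) - f (u, v)) = (LBINT v=c..d. f (x, y) - g u v)"
      by (rule interval_integral_cong) (simp add: g_def mixed_diff_def)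
    also have "\<dots> = f (x, y) * (d - c) - I u"
      unfolding I_def using int_g by (simp add: interval_lebesgue_integral_diff)
    finally show ?thesis .
  qed
  have "(LBINT u=a..b. (LBINT v=c..d. f (x, v) + f (u, y) - f (u, v)))
      = f (x, y) * (d - c) * (b - a) - (LBINT u=a..b. I u)"
    unfolding inner using int_I by (simp add: interval_lebesgue_integral_diff)
  moreover have "\<bar>LBINT u=a..b. I u\<bar> \<le> (M * L) * ((b - a)\<^sup>2 / 2 + \<bar>a - x\<bar> * (b - a))"
  proof (rule abs_interval_integral_le_linear[OF \<open>a \<le> b\<close> cont_I])
    fix u assume "u \<in> {a..b}"
    have "\<bar>I u\<bar> \<le> (M * L) * \<bar>u - x\<bar>"
      using I_le[of u] by (simp add: mult_ac)
    also have "\<dots> \<le> (M * L) * ((u - a) + \<bar>a - x\<bar>)"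
      using \<open>u \<in> {a..b}\<close> near[of a u x] \<open>M \<ge> 0\<close> \<open>L \<ge> 0\<close> by (intro mult_left_mono) auto
    finally show "\<bar>I u\<bar> \<le> (M * L) * ((u - a) + \<bar>a - x\<bar>)" .
  qed
  ultimately show ?thesis
    unfolding L_def by (simp add: mult_ac)
qed

lemma scaled_cell_integral_error_le:
  fixes k j :: int
  assumes mixed: "\<And>x y u v. \<bar>mixed_diff f (x, y) (u, v)\<bar> \<le> M * (\<bar>u - x\<bar> * \<bar>v - y\<bar>)"
    and "M \<ge> 0" "w > 0"
  shows "\<bar>w\<^sup>2 * (LBINT u = ereal (real_of_int k / w) .. ereal ((real_of_int k + 1) / w).
         (LBINT v = ereal (real_of_int j / w) .. ereal ((real_of_int j + 1) / w).
           f (x, v) + f (u, y) - f (u, v))) - f (x, y)\<bar>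
    \<le> M / (4 * w\<^sup>2) * ((1 + 2 * \<bar>w * x - k\<bar>) * (1 + 2 * \<bar>w * y - j\<bar>))"
proof -
  define J where "J = (LBINT u = ereal (real_of_int k / w) .. ereal ((real_of_int k + 1) / w).
         (LBINT v = ereal (real_of_int j / w) .. ereal ((real_of_int j + 1) / w).
           f (x, v) + f (u, y) - f (u, v)))"
  have side: "(real_of_int i + 1) / w - real_of_int i / w = 1 / w" for i
    by (simp add: diff_divide_distrib[symmetric])
  have half: "(1 / w)\<^sup>2 / 2 + \<bar>real_of_int i / w - z\<bar> * (1 / w) = (1 + 2 * \<bar>w * z - i\<bar>) / (2 * w\<^sup>2)" for i z
  proof -
    have "\<bar>real_of_int i / w - z\<bar> = \<bar>(w * z - i) / w\<bar>"
      using \<open>w > 0\<close> by (subst abs_minus_commute) (simp add: field_simps)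
    also have "\<dots> = \<bar>w * z - i\<bar> / w"
      using \<open>w > 0\<close> by simp
    finally show ?thesis
      using \<open>w > 0\<close> by (simp add: field_simps power2_eq_square)
  qed
  define p q where "p = 1 + 2 * \<bar>w * x - k\<bar>" and "q = 1 + 2 * \<bar>w * y - j\<bar>"
  have "real_of_int i / w \<le> (real_of_int i + 1) / w" for i
    using \<open>w > 0\<close> by (simp add: divide_right_mono)
  from cell_integral_error_le[OF mixed \<open>M \<ge> 0\<close> this[of k] this[of j], of x y]
  have J: "\<bar>J - f (x, y) * (1 / w * (1 / w))\<bar> \<le> M * (p / (2 * w\<^sup>2) * (q / (2 * w\<^sup>2)))"
    unfolding side half J_def p_def q_def .
  have "w\<^sup>2 * J - f (x, y) = w\<^sup>2 * (J - f (x, y) * (1 / w * (1 / w)))"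
    using \<open>w > 0\<close> by (simp add: field_simps power2_eq_square)
  then have "\<bar>w\<^sup>2 * J - f (x, y)\<bar> = w\<^sup>2 * \<bar>J - f (x, y) * (1 / w * (1 / w))\<bar>"
    by (simp add: abs_mult)
  also have "\<dots> \<le> w\<^sup>2 * (M * (p / (2 * w\<^sup>2) * (q / (2 * w\<^sup>2))))"
    using J by (rule mult_left_mono) simp
  also have "\<dots> = M / (4 * w\<^sup>2) * (p * q)"
    using \<open>w > 0\<close> by (simp add: field_simps)
  finally show ?thesis
    unfolding J_def p_def q_def .
qed

section \<open>Iterated series and absolute moments\<close>

lemma sum_le_infsum_ennreal:
  fixes h :: "'a \<Rightarrow> ennreal"
  assumes "finite S"
  shows "sum h S \<le> infsum h UNIV"
proof -
  have "infsum h S \<le> infsum h UNIV"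
    by (intro infsum_mono_neutral nonneg_summable_on_complete) auto
  then show ?thesis
    using assms by simp
qed

text \<open>A finite set of pairs lies in the product of its projections, so its partial sum is a part of
  finitely many inner sums over finitely many indices.\<close>

lemma iterated_ennreal_sum_imp_summable:
  fixes t :: "'a \<times> 'b \<Rightarrow> real"
  assumes nonneg: "\<And>p. t p \<ge> 0" and "m \<ge> 0"
    and le: "(\<Sum>\<^sub>\<infinity>k. \<Sum>\<^sub>\<infinity>j. ennreal (t (k, j))) \<le> ennreal m"
  shows "t summable_on UNIV" and "infsum t UNIV \<le> m"
proof -
  have fin: "sum t F \<le> m" if "finite F" for F
  proof -
    have "ennreal (sum t F) \<le> ennreal (sum t (fst ` F \<times> snd ` F))"
      using that nonneg by (intro ennreal_leI sum_mono2 finite_cartesian_product finite_imageI subset_fst_snd)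
    also have "\<dots> = (\<Sum>k\<in>fst ` F. \<Sum>j\<in>snd ` F. ennreal (t (k, j)))"
      using nonneg by (simp add: sum_nonneg sum.cartesian_product)
    also have "\<dots> \<le> (\<Sum>k\<in>fst ` F. \<Sum>\<^sub>\<infinity>j. ennreal (t (k, j)))"
      using that by (intro sum_mono sum_le_infsum_ennreal) auto
    also have "\<dots> \<le> (\<Sum>\<^sub>\<infinity>k. \<Sum>\<^sub>\<infinity>j. ennreal (t (k, j)))"
      using that by (intro sum_le_infsum_ennreal) auto
    finally have "ennreal (sum t F) \<le> ennreal m"
      using le by (rule order_trans)
    then show ?thesis
      using \<open>m \<ge> 0\<close> by (simp add: ennreal_le_iff)
  qed
  show "t summable_on UNIV"
    using nonneg fin by (intro nonneg_bdd_above_summable_on bdd_aboveI2[of _ _ m]) auto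
  then show "infsum t UNIV \<le> m"
    using fin by (intro infsum_le_finite_sums) auto
qed

lemma moment_series_summable:
  fixes chi :: "real \<times> real \<Rightarrow> real"
  assumes "abs_moment p1 p2 chi < \<infinity>"
  defines "t \<equiv> \<lambda>u v (k, j). \<bar>chi (u - real_of_int k, v - real_of_int j)\<bar>
             * \<bar>u - real_of_int k\<bar> ^ p1 * \<bar>v - real_of_int j\<bar> ^ p2"
  shows "t u v summable_on UNIV" and "infsum (t u v) UNIV \<le> enn2real (abs_moment p1 p2 chi)"
proof -
  have "(\<Sum>\<^sub>\<infinity>k. \<Sum>\<^sub>\<infinity>j. ennreal (t u v (k, j))) \<le> abs_moment p1 p2 chi"
    unfolding abs_moment_def t_def by (rule SUP_upper2[of "(u, v)"]) auto
  also have "\<dots> = ennreal (enn2real (abs_moment p1 p2 chi))"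
    using assms(1) by (simp add: less_top)
  finally have le: "(\<Sum>\<^sub>\<infinity>k. \<Sum>\<^sub>\<infinity>j. ennreal (t u v (k, j))) \<le> \<dots>" .
  have nonneg: "t u v p \<ge> 0" for p
    by (simp add: t_def split: prod.splits)
  show "t u v summable_on UNIV" "infsum (t u v) UNIV \<le> enn2real (abs_moment p1 p2 chi)"
    by (rule iterated_ennreal_sum_imp_summable[OF nonneg enn2real_nonneg le])+
qed

text \<open>Here \<open>T\<close> is the kernel weighted by \<open>(1 + 2 * \<bar>w * x - k\<bar>) * (1 + 2 * \<bar>w * y - j\<bar>)\<close>. It dominates the
  error terms, which makes all series over pairs absolutely convergent and lets the iterated sums
  be rearranged.\<close>

lemma GBS_Kantorovich_error_le_finite_moments:
  assumes kernel: "\<And>u v. (\<Sum>\<^sub>\<infinity>k. \<Sum>\<^sub>\<infinity>j. chi (u - real_of_int k, v - real_of_int j)) = 1"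
    and fin: "abs_moment 0 0 chi < \<infinity>" "abs_moment 1 0 chi < \<infinity>"
      "abs_moment 0 1 chi < \<infinity>" "abs_moment 1 1 chi < \<infinity>"
    and mixed: "\<And>x y u v. \<bar>mixed_diff f (x, y) (u, v)\<bar> \<le> M * (\<bar>u - x\<bar> * \<bar>v - y\<bar>)"
    and "M \<ge> 0" "w > 0"
  shows "ennreal \<bar>GBS_Kantorovich chi w f (x, y) - f (x, y)\<bar> \<le> coeff_D chi w * ennreal M"
proof -
  define m where "m p1 p2 = enn2real (abs_moment p1 p2 chi)" for p1 p2
  define c where "c = (\<lambda>(k, j). chi (w * x - real_of_int k, w * y - real_of_int j))"
  define t where "t p1 p2 = (\<lambda>(k, j). \<bar>c (k, j)\<bar>
             * \<bar>w * x - real_of_int k\<bar> ^ p1 * \<bar>w * y - real_of_int j\<bar> ^ p2)" for p1 p2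
  define A where "A = (\<lambda>(k, j). w\<^sup>2 * (LBINT u = ereal (real_of_int k / w) .. ereal ((real_of_int k + 1) / w).
         (LBINT v = ereal (real_of_int j / w) .. ereal ((real_of_int j + 1) / w).
           f (x, v) + f (u, y) - f (u, v))))"
  define T where "T p = t 0 0 p + 2 * t 1 0 p + 2 * t 0 1 p + 4 * t 1 1 p" for p
  have sm: "t p1 p2 summable_on UNIV" "infsum (t p1 p2) UNIV \<le> m p1 p2"
    if "abs_moment p1 p2 chi < \<infinity>" for p1 p2
    using moment_series_summable[OF that, of "w * x" "w * y"]
    by (simp_all add: t_def c_def m_def)
  have T: "(T has_sum (infsum (t 0 0) UNIV + 2 * infsum (t 1 0) UNIV + 2 * infsum (t 0 1) UNIV
      + 4 * infsum (t 1 1) UNIV)) UNIV"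
    unfolding T_def by (intro has_sum_add has_sum_cmult_right has_sum_infsum sm fin)
  have T_le: "infsum T UNIV \<le> m 0 0 + 2 * m 1 0 + 2 * m 0 1 + 4 * m 1 1"
    using T sm(2) fin by (simp add: infsumI add_mono)
  have err: "\<bar>c p * (A p - f (x, y))\<bar> \<le> M / (4 * w\<^sup>2) * T p" for p
  proof -
    obtain k j where p: "p = (k, j)" by fastforce
    have "\<bar>c p\<bar> * \<bar>A p - f (x, y)\<bar>
        \<le> \<bar>c p\<bar> * (M / (4 * w\<^sup>2) * ((1 + 2 * \<bar>w * x - k\<bar>) * (1 + 2 * \<bar>w * y - j\<bar>)))"
      unfolding p A_def using scaled_cell_integral_error_le[OF mixed \<open>M \<ge> 0\<close> \<open>w > 0\<close>, of k j x y]
      by (intro mult_left_mono) auto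
    also have "\<dots> = M / (4 * w\<^sup>2) * T p"
      unfolding p T_def t_def by (simp add: algebra_simps)
    finally show ?thesis
      by (simp add: abs_mult)
  qed
  have maj: "(\<lambda>p. M / (4 * w\<^sup>2) * T p) summable_on UNIV"
    using T by (intro summable_on_cmult_right) (auto simp: summable_on_def)
  have err_abs: "(\<lambda>p. norm (c p * (A p - f (x, y)))) summable_on UNIV"
    by (rule Infinite_Sum.abs_summable_on_comparison_test'[OF maj]) (use err in auto)
  have c_abs: "(\<lambda>p. norm (c p)) summable_on UNIV"
    using sm(1)[OF fin(1)] by (simp add: t_def case_prod_unfold)
  have sum_c: "infsum c UNIV = 1"
    using infsum_Sigma'_banach[of "\<lambda>k j. c (k, j)" UNIV "\<lambda>_. UNIV"] abs_summable_summable[OF c_abs]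
      kernel[of "w * x" "w * y"] by (simp add: c_def)
  have cA: "((\<lambda>p. c p * A p) has_sum (infsum (\<lambda>p. c p * (A p - f (x, y))) UNIV + f (x, y))) UNIV"
  proof -
    have "((\<lambda>p. c p * (A p - f (x, y)) + c p * f (x, y)) has_sum
        (infsum (\<lambda>p. c p * (A p - f (x, y))) UNIV + infsum c UNIV * f (x, y))) UNIV"
      by (intro has_sum_add has_sum_cmult_left has_sum_infsum
          abs_summable_summable[OF err_abs] abs_summable_summable[OF c_abs])
    moreover have "c p * (A p - f (x, y)) + c p * f (x, y) = c p * A p" for p
      by (simp add: right_diff_distrib)
    ultimately show ?thesis
      by (simp only: sum_c mult_1)
  qed
  have "GBS_Kantorovich chi w f (x, y) = (\<Sum>\<^sub>\<infinity>k. \<Sum>\<^sub>\<infinity>j. c (k, j) * A (k, j))"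
    unfolding GBS_Kantorovich_def c_def A_def split_conv mult.assoc ..
  also have "\<dots> = infsum (\<lambda>(k, j). c (k, j) * A (k, j)) (UNIV \<times> UNIV)"
  proof (rule infsum_Sigma'_banach)
    show "(\<lambda>(k, j). c (k, j) * A (k, j)) summable_on UNIV \<times> UNIV"
      using has_sum_imp_summable[OF cA] unfolding UNIV_Times_UNIV
      by (rule back_subst[of "\<lambda>h. h summable_on UNIV"]) fastforce
  qed
  also have "\<dots> = infsum (\<lambda>p. c p * A p) UNIV"
    unfolding UNIV_Times_UNIV by (rule infsum_cong) auto
  also have "\<dots> = infsum (\<lambda>p. c p * (A p - f (x, y))) UNIV + f (x, y)"
    using cA by (rule infsumI)
  finally have "\<bar>GBS_Kantorovich chi w f (x, y) - f (x, y)\<bar> = \<bar>infsum (\<lambda>p. c p * (A p - f (x, y))) UNIV\<bar>"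
    by simp
  also have "\<dots> \<le> infsum (\<lambda>p. \<bar>c p * (A p - f (x, y))\<bar>) UNIV"
    using norm_infsum_bound[OF err_abs] by simp
  also have "\<dots> \<le> infsum (\<lambda>p. M / (4 * w\<^sup>2) * T p) UNIV"
    using err_abs maj err by (intro infsum_mono) auto
  also have "\<dots> = M / (4 * w\<^sup>2) * infsum T UNIV"
    by (rule infsum_cmult_right')
  also have "\<dots> \<le> M / (4 * w\<^sup>2) * (m 0 0 + 2 * m 1 0 + 2 * m 0 1 + 4 * m 1 1)"
    using T_le \<open>M \<ge> 0\<close> by (intro mult_left_mono) auto
  finally have "ennreal \<bar>GBS_Kantorovich chi w f (x, y) - f (x, y)\<bar>
      \<le> ennreal (1 / (4 * w\<^sup>2) * (m 0 0 + 2 * m 1 0 + 2 * m 0 1 + 4 * m 1 1) * M)"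
    by (intro ennreal_leI) (simp add: mult_ac)
  also have "\<dots> = coeff_D chi w * ennreal M"
  proof -
    have "abs_moment 0 0 chi = ennreal (m 0 0)" "abs_moment 1 0 chi = ennreal (m 1 0)"
      "abs_moment 0 1 chi = ennreal (m 0 1)" "abs_moment 1 1 chi = ennreal (m 1 1)"
      using fin by (auto simp: m_def less_top)
    moreover have "m p1 p2 \<ge> 0" for p1 p2
      by (simp add: m_def)
    ultimately have "ennreal (m 0 0 + 2 * m 1 0 + 2 * m 0 1 + 4 * m 1 1)
        = abs_moment 0 0 chi + 2 * abs_moment 1 0 chi + 2 * abs_moment 0 1 chi + 4 * abs_moment 1 1 chi"
      by (simp add: ennreal_mult)
    moreover have "ennreal (1 / (4 * w\<^sup>2) * s * M) = ennreal (1 / (4 * w\<^sup>2)) * ennreal s * ennreal M" for s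
      by (subst ennreal_mult''[OF \<open>M \<ge> 0\<close>], subst ennreal_mult') simp_all
    ultimately show ?thesis
      by (simp only: coeff_D_def)
  qed
  finally show ?thesis .
qed

text \<open>Since \<open>\<infinity> * 0 = 0\<close>, the case \<open>M = 0\<close> asserts exact reproduction of \<open>f\<close>, also when a moment is
  infinite. It holds termwise, as each cell average equals \<open>f (x, y)\<close>.\<close>

lemma GBS_Kantorovich_error_le:
  assumes kernel: "\<And>u v. (\<Sum>\<^sub>\<infinity>k. \<Sum>\<^sub>\<infinity>j. chi (u - real_of_int k, v - real_of_int j)) = 1"
    and mixed: "\<And>x y u v. \<bar>mixed_diff f (x, y) (u, v)\<bar> \<le> M * (\<bar>u - x\<bar> * \<bar>v - y\<bar>)"
    and "M \<ge> 0" "w > 0"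
  shows "ennreal \<bar>GBS_Kantorovich chi w f (x, y) - f (x, y)\<bar> \<le> coeff_D chi w * ennreal M"
proof (cases "M = 0")
  case True
  have "w\<^sup>2 * (LBINT u = ereal (real_of_int k / w) .. ereal ((real_of_int k + 1) / w).
         (LBINT v = ereal (real_of_int j / w) .. ereal ((real_of_int j + 1) / w).
           f (x, v) + f (u, y) - f (u, v))) = f (x, y)" for k j
    using scaled_cell_integral_error_le[OF mixed \<open>M \<ge> 0\<close> \<open>w > 0\<close>, of k j x y] True by simp
  then have "GBS_Kantorovich chi w f (x, y) = f (x, y)"
    by (simp add: GBS_Kantorovich_def mult.assoc infsum_cmult_left' kernel)
  then show ?thesis
    by simp
next
  case False
  have scale: "ennreal (1 / (4 * w\<^sup>2)) \<noteq> 0"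
    using \<open>w > 0\<close> by (simp add: ennreal_eq_0_iff not_le)
  show ?thesis
  proof (cases "abs_moment 0 0 chi < \<infinity> \<and> abs_moment 1 0 chi < \<infinity>
      \<and> abs_moment 0 1 chi < \<infinity> \<and> abs_moment 1 1 chi < \<infinity>")
    case True
    then show ?thesis
      using GBS_Kantorovich_error_le_finite_moments[OF kernel _ _ _ _ mixed \<open>M \<ge> 0\<close> \<open>w > 0\<close>] by blast
  next
    case infinite: False
    then have "coeff_D chi w = \<infinity>"
      using scale by (auto simp: coeff_D_def less_top[symmetric] ennreal_mult_eq_top_iff)
    then show ?thesis
      using False \<open>M \<ge> 0\<close> by (simp add: ennreal_top_mult ennreal_eq_0_iff)
  qed
qed

theorem theorem7:
  fixes chi f :: "real \<times> real \<Rightarrow> real" and w \<delta>1 \<delta>2 x y :: real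
  assumes "sampling_kernel chi"
    and "\<And>p. B_differentiable f p"
    and "bounded (range (B_deriv f))"
    and "w > 0" and "\<delta>1 > 0" and "\<delta>2 > 0"
  shows "ennreal \<bar>GBS_Kantorovich chi w f (x, y) - f (x, y)\<bar>
    \<le> coeff_D chi w * (3 * sup_norm (B_deriv f) + mixed_modulus (B_deriv f) \<delta>1 \<delta>2)
      + (coeff_E chi w * ennreal (1 / \<delta>1) + coeff_F chi w * ennreal (1 / \<delta>2)
         + coeff_G chi w * ennreal (1 / (\<delta>1 * \<delta>2))) * mixed_modulus (B_deriv f) \<delta>1 \<delta>2"
proof -
  obtain B where B: "\<And>p. \<bar>B_deriv f p\<bar> \<le> B"
    using assms(3) by (auto simp: bounded_iff)
  define M where "M = enn2real (sup_norm (B_deriv f))"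
  have "sup_norm (B_deriv f) \<le> ennreal B"
    unfolding sup_norm_def using B by (intro SUP_least ennreal_leI)
  then have "sup_norm (B_deriv f) < \<infinity>"
    by (rule le_less_trans) simp
  then have M: "sup_norm (B_deriv f) = ennreal M"
    by (simp add: M_def less_top)
  have "M \<ge> 0"
    by (simp add: M_def)
  have "ennreal \<bar>B_deriv f p\<bar> \<le> ennreal M" for p
    unfolding M[symmetric] sup_norm_def by (rule SUP_upper) simp
  then have bound: "\<bar>B_deriv f p\<bar> \<le> M" for p
    using \<open>M \<ge> 0\<close> by (simp add: ennreal_le_iff)
  have "ennreal \<bar>GBS_Kantorovich chi w f (x, y) - f (x, y)\<bar> \<le> coeff_D chi w * sup_norm (B_deriv f)"
    unfolding M using assms(1) mixed_diff_le[OF assms(2) bound] \<open>M \<ge> 0\<close> \<open>w > 0\<close>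
    by (intro GBS_Kantorovich_error_le) (auto simp: sampling_kernel_def)
  also have "\<dots> \<le> coeff_D chi w * (3 * sup_norm (B_deriv f) + mixed_modulus (B_deriv f) \<delta>1 \<delta>2)"
  proof (rule mult_left_mono)
    have "1 * sup_norm (B_deriv f) \<le> 3 * sup_norm (B_deriv f)"
      by (rule mult_right_mono) simp_all
    then show "sup_norm (B_deriv f) \<le> 3 * sup_norm (B_deriv f) + mixed_modulus (B_deriv f) \<delta>1 \<delta>2"
      by (simp add: add_increasing2)
  qed simp
  finally show ?thesis
    by (rule order_trans) simp
qed

end
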